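(* Let $\omega:[0,+\infty)\to[0,+\infty)$ be a weight function such that $\omega(t)=O(t)$ as $t\to+\infty$, $\log(t)=o(\omega(t))$ as $t\to+\infty$, $\varphi_\omega:t\mapsto\omega(e^t)$ is convex on $\mathbb{R}$, and $\liminf_{t\to+\infty}\frac{\omega(t)}{t}=0$. Let $\Omega$ be the matrix associated with $\omega$. Assume in addition that $$\exists\,H>0\ \exists\,C>0\ \forall\,t\ge0:\quad(\omega^\iota)_\star(t^2)\le C\omega(Ht)+C$$ (equivalently, that $\mathcal{F}_{\{\Omega\}}$ is stable under the pointwise product $\odot$; equivalently, that $\mathcal{F}_{(\Omega)}$ is stable under $\odot$). Then $\omega$ is non-quasianalytic, i.e. $\int_1^{+\infty}\frac{\omega(t)}{t^2}\,dt<+\infty$.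
   Context: $\mathbb{N}=\{0,1,2,\dots\}$. A weight function is a continuous, increasing (i.e. nondecreasing) function $\omega:[0,+\infty)\to[0,+\infty)$ with $\omega(t)=0$ for $t\in[0,1]$ and $\lim_{t\to+\infty}\omega(t)=+\infty$. Lower Legendre conjugate: $\omega^\iota(s):=\omega(1/s)$ for $s>0$, and $(\omega^\iota)_\star(t):=\inf_{s>0}\{\omega(1/s)+ts\}$ for $t\ge0$. Associated matrix: $\varphi^*_\omega(x):=\sup\{xy-\varphi_\omega(y):y\ge0\}$ for $x\ge0$, and $\Omega:=\{W^{(\lambda)}:\lambda>0\}$ with $W^{(\lambda)}_j:=\exp\big(\frac1\lambda\varphi^*_\omega(\lambda j)\big)$, $j\in\mathbb{N}$; $w^{(\lambda)}_j:=W^{(\lambda)}_j/j!$. $\mathcal{F}_{\{\Omega\}}$, resp. $\mathcal{F}_{(\Omega)}$, is the space of formal power series $\mathbf{F}=\sum_{j\ge0}F_jx^j$ with complex coefficients such that for some $\lambda>0$ and some $h>0$, resp. for all $\lambda>0$ and all $h>0$, $\sup_j\frac{|F_j|}{h^jw^{(\lambda)}_j}<+\infty$. The pointwise (Hadamard) product is $\mathbf{F}\odot\mathbf{G}=\sum_{j\ge0}F_jG_jx^j$; stable means closed under $\odot$. *)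

theory Defs
  imports
    "HOL-Analysis.Analysis"
    "HOL-Library.Landau_Symbols"
    "HOL-Library.Liminf_Limsup"
    "HOL-Computational_Algebra.Formal_Power_Series"
begin

text \<open>A function on \<open>[0,\<infinity>)\<close> is represented by a total function on the reals of which only the
  restriction to \<open>{0..}\<close> is ever used.\<close>

definition weight_function :: "(real \<Rightarrow> real) \<Rightarrow> bool" where
  "weight_function \<omega> \<longleftrightarrow>
     continuous_on {0..} \<omega> \<and> mono_on {0..} \<omega> \<and> (\<forall>t\<ge>0. 0 \<le> \<omega> t) \<and>
     (\<forall>t\<in>{0..1}. \<omega> t = 0) \<and> filterlim \<omega> at_top at_top"

definition weight_phi :: "(real \<Rightarrow> real) \<Rightarrow> real \<Rightarrow> real" where
  "weight_phi \<omega> t = \<omega> (exp t)"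

definition weight_iota :: "(real \<Rightarrow> real) \<Rightarrow> real \<Rightarrow> real" where
  "weight_iota \<omega> s = \<omega> (1 / s)"

definition lower_legendre :: "(real \<Rightarrow> real) \<Rightarrow> real \<Rightarrow> real" where
  "lower_legendre g t = (INF s\<in>{0<..}. g s + t * s)"

text \<open>The supremum is taken in the reals. It is finite for every \<open>x \<ge> 0\<close> as soon as \<open>\<omega> \<ge> 0\<close> and
  \<open>log t = o(\<omega>(t))\<close>.\<close>

definition phi_star :: "(real \<Rightarrow> real) \<Rightarrow> real \<Rightarrow> real" where
  "phi_star \<omega> x = (SUP y\<in>{0..}. x * y - weight_phi \<omega> y)"

definition assoc_W :: "(real \<Rightarrow> real) \<Rightarrow> real \<Rightarrow> nat \<Rightarrow> real" where
  "assoc_W \<omega> lam j = exp (1 / lam * phi_star \<omega> (lam * real j))"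

definition assoc_w :: "(real \<Rightarrow> real) \<Rightarrow> real \<Rightarrow> nat \<Rightarrow> real" where
  "assoc_w \<omega> lam j = assoc_W \<omega> lam j / fact j"

text \<open>Since the quotients are real and nonnegative, their supremum is finite iff they are bounded
  above.\<close>

definition fps_growth :: "(real \<Rightarrow> real) \<Rightarrow> real \<Rightarrow> real \<Rightarrow> complex fps \<Rightarrow> bool" where
  "fps_growth \<omega> lam h F \<longleftrightarrow>
     bdd_above (range (\<lambda>j. cmod (fps_nth F j) / (h ^ j * assoc_w \<omega> lam j)))"

definition F_roumieu :: "(real \<Rightarrow> real) \<Rightarrow> complex fps set" where
  "F_roumieu \<omega> = {F. \<exists>lam>0. \<exists>h>0. fps_growth \<omega> lam h F}"

definition F_beurling :: "(real \<Rightarrow> real) \<Rightarrow> complex fps set" where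
  "F_beurling \<omega> = {F. \<forall>lam>0. \<forall>h>0. fps_growth \<omega> lam h F}"

definition fps_hadamard :: "complex fps \<Rightarrow> complex fps \<Rightarrow> complex fps" where
  "fps_hadamard F G = Abs_fps (\<lambda>j. fps_nth F j * fps_nth G j)"

definition hadamard_stable :: "complex fps set \<Rightarrow> bool" where
  "hadamard_stable S \<longleftrightarrow> (\<forall>F\<in>S. \<forall>G\<in>S. fps_hadamard F G \<in> S)"

definition iota_star_condition :: "(real \<Rightarrow> real) \<Rightarrow> bool" where
  "iota_star_condition \<omega> \<longleftrightarrow>
     (\<exists>H>0. \<exists>C>0. \<forall>t\<ge>0. lower_legendre (weight_iota \<omega>) (t\<^sup>2) \<le> C * \<omega> (H * t) + C)"

definition nonquasianalytic :: "(real \<Rightarrow> real) \<Rightarrow> bool" where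
  "nonquasianalytic \<omega> \<longleftrightarrow>
     (\<integral>\<^sup>+ t\<in>{1..}. ennreal (\<omega> t / t\<^sup>2) \<partial>lborel) < \<infinity>"

end

theory Submission imports Defs begin

text \<open>Write \<open>W\<close>, \<open>W'\<close> for the sequences with parameters \<open>\<lambda>\<close>, \<open>\<lambda>'\<close>. Stability in either sense gives
  \<open>W\<^sub>j\<^sup>2 \<le> K h\<^sup>j j! W'\<^sub>j\<close> for one pair \<open>\<lambda>\<close>, \<open>\<lambda>'\<close>, and follows from it for all pairs \<open>\<lambda>' = C \<lambda>\<close> with fixed
  \<open>C\<close>. As \<open>W\<^sub>j\<close> is the supremum of \<open>t\<^sup>j exp (- \<omega>(t)/\<lambda>)\<close> over \<open>t \<ge> 1\<close>, inserting the lower bound on \<open>\<omega>\<close>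
  from the condition on the Legendre conjugate yields the inequality for all these pairs; conversely,
  the inequality for one pair gives back the condition by a discrete Legendre duality.

  For non-quasianalyticity, the condition at \<open>t\<close> provides \<open>r\<close> with \<open>\<omega>(r) \<le> 2C \<omega>(t)\<close> and
  \<open>r \<ge> t\<^sup>2 / (2C H\<^sup>2 \<omega>(t))\<close>, so \<open>\<omega>(A t) \<le> 2C \<omega>(t)\<close> with \<open>A = (2C)\<^sup>2\<close> as soon as \<open>\<omega>(t)/t\<close> is small.
  By the assumption on the limit inferior this can be started somewhere, it then propagates along
  \<open>A\<^sup>k t\<close>, and \<open>\<omega>(t) = O(\<surd>t)\<close> follows.\<close>

section \<open>Elementary inequalities for powers, exponentials and factorials\<close>

text \<open>A single term of the exponential series is at most its sum. This is the source of the
  factor \<open>fact j\<close> in the matrix inequality.\<close>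

lemma power_times_exp_minus_le:
  fixes x a :: real
  assumes "x \<ge> 0" "a > 0"
  shows "x ^ j * exp (- (a * x)) \<le> fact j / a ^ j"
proof -
  have "summable (\<lambda>n. (a * x) ^ n /\<^sub>R fact n)" using summable_exp_generic[of "a * x"] .
  then have "sum (\<lambda>n. (a * x) ^ n /\<^sub>R fact n) {j} \<le> exp (a * x)"
    unfolding exp_def by (rule sum_le_suminf) (use assms in auto)
  then have "(a * x) ^ j \<le> fact j * exp (a * x)" by (simp add: field_simps)
  then show ?thesis using assms by (simp add: exp_minus field_simps)
qed

text \<open>Bernoulli's inequality gives (1 + 1/n)^n >= 2, which drives the induction. The gain over
  n! <= n^n outweighs an exponential error in the discrete duality.\<close>

lemma fact_mult_2_power_le: "fact n * 2 ^ n \<le> (2 * real n ^ n :: real)"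
proof (induction n)
  case (Suc n)
  show ?case
  proof (cases "n = 0")
    case False
    have "2 * real n ^ n \<le> real (Suc n) ^ n"
    proof -
      have "1 + real n * (1 / real n) \<le> (1 + 1 / real n) ^ n"
        by (rule Bernoulli_inequality) (simp add: order_trans[of _ 0])
      then have "2 * real n ^ n \<le> (1 + 1 / real n) ^ n * real n ^ n"
        using False by (intro mult_right_mono) auto
      also have "\<dots> = ((1 + 1 / real n) * real n) ^ n" by (rule power_mult_distrib[symmetric])
      also have "(1 + 1 / real n) * real n = real (Suc n)" using False by (simp add: field_simps)
      finally show ?thesis .
    qed
    then have "(2 * real n ^ n) * (2 * real (Suc n)) \<le> real (Suc n) ^ n * (2 * real (Suc n))"
      by (intro mult_right_mono) auto
    moreover have "(fact n * 2 ^ n) * (2 * real (Suc n)) \<le> (2 * real n ^ n) * (2 * real (Suc n))"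
      using Suc by (intro mult_right_mono) auto
    ultimately show ?thesis by (simp add: mult_ac)
  qed simp
qed simp

section \<open>Weights that dominate the logarithm, and the associated matrix\<close>

locale log_small_weight =
  fixes \<omega> :: "real \<Rightarrow> real"
  assumes weight: "weight_function \<omega>"
    and ln_small: "(\<lambda>t. ln t) \<in> o[at_top](\<omega>)"
begin

lemma weight_cont: "continuous_on {0..} \<omega>"
  and weight_mono: "\<lbrakk>0 \<le> s; s \<le> t\<rbrakk> \<Longrightarrow> \<omega> s \<le> \<omega> t"
  and weight_nonneg: "0 \<le> t \<Longrightarrow> 0 \<le> \<omega> t"
  and weight_eq_0: "\<lbrakk>0 \<le> t; t \<le> 1\<rbrakk> \<Longrightarrow> \<omega> t = 0"
  and weight_at_top: "filterlim \<omega> at_top at_top"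
  using weight unfolding weight_function_def mono_on_def by auto

lemma weight_ge_ln:
  obtains T where "T \<ge> 1" "\<And>t. t \<ge> T \<Longrightarrow> c * ln t \<le> \<omega> t"
proof -
  have "eventually (\<lambda>t. norm (ln t) \<le> 1 / (\<bar>c\<bar> + 1) * norm (\<omega> t)) at_top"
    using landau_o.smallD[OF ln_small, of "1 / (\<bar>c\<bar> + 1)"] by simp
  then obtain T0 where T0: "\<And>t. t \<ge> T0 \<Longrightarrow> norm (ln t) \<le> 1 / (\<bar>c\<bar> + 1) * norm (\<omega> t)"
    by (auto simp: eventually_at_top_linorder)
  show ?thesis
  proof (rule that[of "max 1 T0"])
    fix t assume t: "t \<ge> max 1 T0"
    have "\<bar>ln t\<bar> * (\<bar>c\<bar> + 1) \<le> \<omega> t"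
      using T0[of t] t weight_nonneg[of t] by (simp add: field_simps)
    moreover have "c * ln t \<le> \<bar>ln t\<bar> * (\<bar>c\<bar> + 1)"
      using t by (simp add: algebra_simps mult_right_mono add_increasing)
    ultimately show "c * ln t \<le> \<omega> t" by linarith
  qed simp
qed

text \<open>Makes the real supremum in \<open>phi_star\<close> meaningful. The expression is
  nonpositive once exp y >= T, and before that y <= ln T.\<close>

lemma phi_star_bdd: "bdd_above ((\<lambda>y. x * y - weight_phi \<omega> y) ` {0..})"
proof -
  obtain T where T: "T \<ge> 1" "\<And>t. t \<ge> T \<Longrightarrow> x * ln t \<le> \<omega> t"
    using weight_ge_ln[of x] by blast
  have "x * y - weight_phi \<omega> y \<le> \<bar>x\<bar> * ln T" if "y \<ge> 0" for y
  proof (cases "exp y \<ge> T")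
    case True
    then have "x * y - weight_phi \<omega> y \<le> 0"
      using T(2)[of "exp y"] by (simp add: weight_phi_def)
    also have "\<dots> \<le> \<bar>x\<bar> * ln T" using T(1) by simp
    finally show ?thesis .
  next
    case False
    then have "y \<le> ln T" using T(1) by (simp add: ln_ge_iff)
    then have "\<bar>x\<bar> * y \<le> \<bar>x\<bar> * ln T" by (simp add: mult_left_mono)
    moreover have "x * y \<le> \<bar>x\<bar> * y" using that by (simp add: mult_right_mono)
    moreover have "weight_phi \<omega> y \<ge> 0" by (simp add: weight_phi_def weight_nonneg)
    ultimately show ?thesis by linarith
  qed
  then show ?thesis by (intro bdd_aboveI2[of _ _ "\<bar>x\<bar> * ln T"]) simp
qed

text \<open>For t >= 1, put y = ln t in the supremum defining \<open>phi_star\<close>. Below 1 the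
  weight vanishes, and the value at t = 1 shows that \<open>assoc_W\<close> is at least 1.\<close>

lemma assoc_W_ge:
  assumes "lam > 0" "t > 0"
  shows "t ^ j * exp (- \<omega> t / lam) \<le> assoc_W \<omega> lam j"
proof -
  have *: "t ^ j * exp (- \<omega> t / lam) \<le> assoc_W \<omega> lam j" if t: "t \<ge> 1" for t
  proof -
    have "lam * real j * ln t - weight_phi \<omega> (ln t) \<le> phi_star \<omega> (lam * real j)"
      unfolding phi_star_def
      by (rule cSUP_upper[OF _ phi_star_bdd]) (use t in simp)
    then have "(lam * real j * ln t - \<omega> t) / lam \<le> 1 / lam * phi_star \<omega> (lam * real j)"
      using t assms(1) by (simp add: weight_phi_def divide_right_mono)
    moreover have "(lam * real j * ln t - \<omega> t) / lam = real j * ln t + (- \<omega> t / lam)"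
      using assms(1) by (simp add: field_simps)
    moreover have "t ^ j = exp (real j * ln t)"
      using t by (simp add: exp_of_nat_mult)
    ultimately show ?thesis
      unfolding assoc_W_def by (simp flip: exp_add)
  qed
  show ?thesis
  proof (cases "t \<ge> 1")
    case False
    then have "t ^ j * exp (- \<omega> t / lam) \<le> 1"
      using assms(2) weight_eq_0[of t] by (simp add: power_le_one)
    also have "1 \<le> assoc_W \<omega> lam j" using *[of 1] weight_eq_0[of 1] by simp
    finally show ?thesis .
  qed (use * in auto)
qed

text \<open>Together with \<open>assoc_W_ge\<close> this describes \<open>assoc_W\<close> as a
  supremum over t, so that later arguments avoid \<open>phi_star\<close>.\<close>

lemma assoc_W_le:
  assumes "lam > 0" "\<And>t. t \<ge> 1 \<Longrightarrow> t ^ j * exp (- \<omega> t / lam) \<le> B"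
  shows "assoc_W \<omega> lam j \<le> B"
proof -
  have "0 < exp (- \<omega> 1 / lam)" by simp
  also have "\<dots> \<le> B" using assms(2)[of 1] by simp
  finally have B: "B > 0" .
  have "phi_star \<omega> (lam * real j) \<le> lam * ln B"
    unfolding phi_star_def
  proof (rule cSUP_least)
    fix y :: real assume "y \<in> {0..}"
    then have "exp y ^ j * exp (- \<omega> (exp y) / lam) \<le> B" by (intro assms(2)) simp
    then have "exp (real j * y - \<omega> (exp y) / lam) \<le> B"
      by (simp add: exp_diff exp_minus exp_of_nat_mult divide_inverse)
    then have "real j * y - \<omega> (exp y) / lam \<le> ln B" using B by (simp add: ln_ge_iff)
    then show "lam * real j * y - weight_phi \<omega> y \<le> lam * ln B"
      using assms(1) by (simp add: weight_phi_def field_simps)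
  qed simp
  then have "1 / lam * phi_star \<omega> (lam * real j) \<le> ln B"
    using assms(1) by (simp add: field_simps)
  then show ?thesis unfolding assoc_W_def using B by (simp add: ln_ge_iff)
qed

lemma assoc_w_pos [simp]: "assoc_w \<omega> lam j > 0"
  by (simp add: assoc_w_def assoc_W_def)

declare less_imp_le[OF assoc_w_pos, simp]

lemma assoc_w_mono:
  assumes "0 < lam" "lam \<le> lam'"
  shows "assoc_w \<omega> lam j \<le> assoc_w \<omega> lam' j"
proof -
  have "assoc_W \<omega> lam j \<le> assoc_W \<omega> lam' j"
  proof (rule assoc_W_le[OF assms(1)])
    fix t :: real assume t: "t \<ge> 1"
    have "\<omega> t / lam' \<le> \<omega> t / lam" using assms weight_nonneg[of t] t by (intro divide_left_mono) auto
    then have "t ^ j * exp (- \<omega> t / lam) \<le> t ^ j * exp (- \<omega> t / lam')"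
      using t by (intro mult_left_mono) auto
    also have "\<dots> \<le> assoc_W \<omega> lam' j" using assms t by (intro assoc_W_ge) auto
    finally show "t ^ j * exp (- \<omega> t / lam) \<le> assoc_W \<omega> lam' j" .
  qed
  then show ?thesis by (simp add: assoc_w_def divide_right_mono)
qed

lemma fps_growth_iff:
  assumes "h > 0"
  shows "fps_growth \<omega> lam h F \<longleftrightarrow> (\<exists>K>0. \<forall>j. cmod (fps_nth F j) \<le> K * h ^ j * assoc_w \<omega> lam j)"
proof -
  have pos: "h ^ j * assoc_w \<omega> lam j > 0" for j using assms assoc_w_pos by simp
  have "fps_growth \<omega> lam h F \<longleftrightarrow> (\<exists>K. \<forall>j. cmod (fps_nth F j) \<le> K * (h ^ j * assoc_w \<omega> lam j))"
    unfolding fps_growth_def bdd_above_def by (simp add: pos_divide_le_eq[OF pos])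
  also have "\<dots> \<longleftrightarrow> (\<exists>K>0. \<forall>j. cmod (fps_nth F j) \<le> K * (h ^ j * assoc_w \<omega> lam j))"
  proof safe
    fix K assume K: "\<forall>j. cmod (fps_nth F j) \<le> K * (h ^ j * assoc_w \<omega> lam j)"
    have "cmod (fps_nth F j) \<le> (\<bar>K\<bar> + 1) * (h ^ j * assoc_w \<omega> lam j)" for j
    proof -
      have "K * (h ^ j * assoc_w \<omega> lam j) \<le> (\<bar>K\<bar> + 1) * (h ^ j * assoc_w \<omega> lam j)"
        using less_imp_le[OF pos] by (intro mult_right_mono) auto
      then show ?thesis using K by (meson order_trans)
    qed
    then show "\<exists>K>0. \<forall>j. cmod (fps_nth F j) \<le> K * (h ^ j * assoc_w \<omega> lam j)"
      by (intro exI[of _ "\<bar>K\<bar> + 1"]) auto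
  qed blast
  finally show ?thesis by (simp add: mult.assoc)
qed

section \<open>The inequality between squares and rows of the matrix\<close>

text \<open>The left side is a coefficient of the Hadamard square of the series with coefficients
  \<open>assoc_w \<omega> lam j\<close>. Multiplication by (j!)^2 turns the bound into one for
  \<open>assoc_W\<close> with an additional factor \<open>fact j\<close>.\<close>

definition square_dominated :: "real \<Rightarrow> real \<Rightarrow> bool" where
  "square_dominated lam lam' \<longleftrightarrow>
     (\<exists>K>0. \<exists>h>0. \<forall>j. (assoc_w \<omega> lam j)\<^sup>2 \<le> K * h ^ j * assoc_w \<omega> lam' j)"

lemma square_dominatedI:
  assumes "h > 0" "\<And>j. (assoc_W \<omega> lam j)\<^sup>2 \<le> K * h ^ j * fact j * assoc_W \<omega> lam' j"
  shows "square_dominated lam lam'"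
proof -
  \<comment> \<open>Positivity of K comes from the case j = 0.\<close>
  have "0 < (assoc_W \<omega> lam 0)\<^sup>2" by (simp add: assoc_W_def)
  also have "\<dots> \<le> K * assoc_W \<omega> lam' 0" using assms(2)[of 0] by simp
  finally have K: "K > 0" using zero_less_mult_pos2[of K "assoc_W \<omega> lam' 0"] by (simp add: assoc_W_def)
  have "(assoc_w \<omega> lam j)\<^sup>2 \<le> K * h ^ j * assoc_w \<omega> lam' j" for j
  proof -
    have "(assoc_w \<omega> lam j)\<^sup>2 = (assoc_W \<omega> lam j)\<^sup>2 / (fact j)\<^sup>2" by (simp add: assoc_w_def power_divide)
    also have "\<dots> \<le> (K * h ^ j * fact j * assoc_W \<omega> lam' j) / (fact j)\<^sup>2"
      using assms(2) by (simp add: divide_right_mono)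
    also have "\<dots> = K * h ^ j * assoc_w \<omega> lam' j"
      by (simp add: assoc_w_def power2_eq_square)
    finally show ?thesis .
  qed
  then show ?thesis unfolding square_dominated_def using K assms(1) by blast
qed

lemma square_dominatedE:
  assumes "square_dominated lam lam'"
  obtains K h where "K > 0" "h > 0"
    "\<And>j. (assoc_W \<omega> lam j)\<^sup>2 \<le> K * h ^ j * fact j * assoc_W \<omega> lam' j"
proof -
  obtain K h where *: "K > 0" "h > 0" "\<And>j. (assoc_w \<omega> lam j)\<^sup>2 \<le> K * h ^ j * assoc_w \<omega> lam' j"
    using assms unfolding square_dominated_def by blast
  have "(assoc_W \<omega> lam j)\<^sup>2 \<le> K * h ^ j * fact j * assoc_W \<omega> lam' j" for j
    using *(3)[of j] by (simp add: assoc_w_def power_divide field_simps power2_eq_square)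
  then show ?thesis using that * by blast
qed

section \<open>The condition on the lower Legendre conjugate\<close>

lemma lower_legendre_bdd: "t \<ge> 0 \<Longrightarrow> bdd_below ((\<lambda>s. weight_iota \<omega> s + t * s) ` {0<..})"
  by (intro bdd_belowI[of _ 0]) (auto simp: weight_iota_def weight_nonneg)

lemma lower_legendre_le:
  assumes "t \<ge> 0" "r > 0"
  shows "lower_legendre (weight_iota \<omega>) t \<le> \<omega> r + t / r"
  using cINF_lower[OF lower_legendre_bdd[OF assms(1)], of "1 / r"] assms
  by (simp add: lower_legendre_def weight_iota_def)

lemma lower_legendre_approx:
  assumes "t \<ge> 0" "lower_legendre (weight_iota \<omega>) t < B"
  obtains r where "r > 0" "\<omega> r + t / r < B"
proof -
  obtain s where "s > 0" "weight_iota \<omega> s + t * s < B"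
    using assms cINF_less_iff[OF _ lower_legendre_bdd[OF assms(1)], of B]
    by (auto simp: lower_legendre_def)
  then show ?thesis by (intro that[of "1 / s"]) (auto simp: weight_iota_def)
qed

text \<open>The infimum is replaced by a near-minimizer s, written r = 1/s; raising C by one makes
  the bound strict, so that such a point exists. Replacing t by t / H moves the scaling to the left
  side.\<close>

lemma iota_star_conditionE:
  assumes "iota_star_condition \<omega>"
  obtains H C where "H > 0" "C \<ge> 1"
    "\<And>t. t > 0 \<Longrightarrow> \<exists>r>0. \<omega> r + t\<^sup>2 / (H\<^sup>2 * r) \<le> C * \<omega> t + C"
proof -
  obtain H C where HC: "H > 0" "C > 0"
    "\<And>t. t \<ge> 0 \<Longrightarrow> lower_legendre (weight_iota \<omega>) (t\<^sup>2) \<le> C * \<omega> (H * t) + C"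
    using assms unfolding iota_star_condition_def by blast
  show ?thesis
  proof (rule that[of H "C + 1"])
    fix t :: real assume t: "t > 0"
    have "lower_legendre (weight_iota \<omega>) ((t / H)\<^sup>2) \<le> C * \<omega> t + C"
      using HC(3)[of "t / H"] t HC by simp
    also have "\<dots> < (C + 1) * \<omega> t + (C + 1)" using weight_nonneg[of t] t by (simp add: algebra_simps)
    finally obtain r where "r > 0" "\<omega> r + (t / H)\<^sup>2 / r < (C + 1) * \<omega> t + (C + 1)"
      by (rule lower_legendre_approx[rotated]) auto
    then show "\<exists>r>0. \<omega> r + t\<^sup>2 / (H\<^sup>2 * r) \<le> (C + 1) * \<omega> t + (C + 1)"
      by (intro exI[of _ r]) (auto simp: power_divide)
  qed (use HC in auto)
qed

text \<open>Split t^2 as r times t^2 / r: powers of r are absorbed by the new row of the matrix,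
  powers of t^2 / r by \<open>power_times_exp_minus_le\<close>. The ratio of the parameters does not
  depend on \<open>lam\<close>, which serves both kinds of stability.\<close>

lemma iota_star_condition_imp_square_dominated:
  assumes "iota_star_condition \<omega>"
  obtains C where "C > 0" "\<And>lam. lam > 0 \<Longrightarrow> square_dominated lam (C * lam)"
proof -
  obtain H C where HC: "H > 0" "C \<ge> 1"
    "\<And>t. t > 0 \<Longrightarrow> \<exists>r>0. \<omega> r + t\<^sup>2 / (H\<^sup>2 * r) \<le> C * \<omega> t + C"
    using iota_star_conditionE[OF assms] by metis
  have "square_dominated lam (C / 2 * lam)" if lam: "lam > 0" for lam
  proof (rule square_dominatedI)
    \<comment> \<open>Multiplying the condition by \<open>2 / (C * lam)\<close> gives t^2 / r the
      coefficient a, and divides \<omega> r by \<open>C / 2 * lam\<close>.\<close>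
    define a where "a = 2 / (C * lam * H\<^sup>2)"
    have a: "a > 0" using HC lam by (simp add: a_def)
    show "1 / a > 0" using a by simp
    fix j
    let ?W = "assoc_W \<omega> (C / 2 * lam) j"
    let ?B = "exp (2 / lam) * (1 / a) ^ j * fact j * ?W"
    have W: "?W > 0" by (simp add: assoc_W_def)
    have "assoc_W \<omega> lam j \<le> sqrt ?B"
    proof (rule assoc_W_le[OF lam])
      fix t :: real assume t: "t \<ge> 1"
      then obtain r where r: "r > 0" "\<omega> r + t\<^sup>2 / (H\<^sup>2 * r) \<le> C * \<omega> t + C"
        using HC(3)[of t] by auto
      have "(\<omega> r + t\<^sup>2 / (H\<^sup>2 * r)) * (2 / (C * lam)) \<le> (C * \<omega> t + C) * (2 / (C * lam))"
        using r(2) by (rule mult_right_mono) (use HC lam in auto)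
      then have le: "- 2 * \<omega> t / lam \<le> 2 / lam - \<omega> r / (C / 2 * lam) - a * (t\<^sup>2 / r)"
        using HC lam r by (simp add: a_def field_simps)
      have "(t ^ j * exp (- \<omega> t / lam))\<^sup>2 = (t\<^sup>2) ^ j * exp (- 2 * \<omega> t / lam)"
        by (simp add: power_mult_distrib flip: power_mult exp_of_nat_mult)
          (simp add: mult.commute exp_double[symmetric])
      also have "\<dots> \<le> (t\<^sup>2) ^ j * exp (2 / lam - \<omega> r / (C / 2 * lam) - a * (t\<^sup>2 / r))"
        using le by (intro mult_left_mono) auto
      also have "\<dots> = (r ^ j * (t\<^sup>2 / r) ^ j) *
          (exp (2 / lam) * exp (- \<omega> r / (C / 2 * lam)) * exp (- (a * (t\<^sup>2 / r))))"
        using r(1) by (simp add: mult_exp_exp power_divide)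
      also have "\<dots> = exp (2 / lam) * (r ^ j * exp (- \<omega> r / (C / 2 * lam))) *
          ((t\<^sup>2 / r) ^ j * exp (- (a * (t\<^sup>2 / r))))"
        by (simp only: mult_ac)
      also have "\<dots> \<le> exp (2 / lam) * ?W * (fact j / a ^ j)"
        using r(1) HC(1,2) lam a
        by (intro mult_mono mult_left_mono assoc_W_ge power_times_exp_minus_le) (auto simp: assoc_W_def)
      also have "\<dots> = ?B" by (simp add: power_divide)
      finally show "t ^ j * exp (- \<omega> t / lam) \<le> sqrt ?B" by (rule real_le_rsqrt)
    qed
    then have "(assoc_W \<omega> lam j)\<^sup>2 \<le> (sqrt ?B)\<^sup>2"
      by (intro power_mono) (auto simp: assoc_W_def)
    also have "\<dots> = ?B" using W a by (intro real_sqrt_pow2) simp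
    finally show "(assoc_W \<omega> lam j)\<^sup>2 \<le> ?B" .
  qed
  then show ?thesis using HC by (intro that[of "C / 2"]) auto
qed

section \<open>The matrix inequality and stability under the pointwise product\<close>

text \<open>Rows increase with the parameter, so both factors can be estimated in the row of the
  larger one before the domination is applied.\<close>

lemma hadamard_stable_roumieu_if:
  assumes dom: "\<And>lam. lam > 0 \<Longrightarrow> \<exists>lam'>0. square_dominated lam lam'"
  shows "hadamard_stable (F_roumieu \<omega>)"
  unfolding hadamard_stable_def
proof (intro ballI)
  fix F G assume "F \<in> F_roumieu \<omega>" "G \<in> F_roumieu \<omega>"
  then obtain l1 h1 l2 h2 where l: "l1 > 0" "h1 > 0" "l2 > 0" "h2 > 0"
    "fps_growth \<omega> l1 h1 F" "fps_growth \<omega> l2 h2 G"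
    unfolding F_roumieu_def by blast
  then obtain K1 K2 where K: "K1 > 0" "K2 > 0"
    "\<And>j. cmod (fps_nth F j) \<le> K1 * h1 ^ j * assoc_w \<omega> l1 j"
    "\<And>j. cmod (fps_nth G j) \<le> K2 * h2 ^ j * assoc_w \<omega> l2 j"
    by (auto simp: fps_growth_iff)
  define lam where "lam = max l1 l2"
  have lam: "lam > 0" using l by (simp add: lam_def)
  obtain lam' K h where P: "lam' > 0" "K > 0" "h > 0"
    "\<And>j. (assoc_w \<omega> lam j)\<^sup>2 \<le> K * h ^ j * assoc_w \<omega> lam' j"
    using dom[OF lam] unfolding square_dominated_def by blast
  have "cmod (fps_nth (fps_hadamard F G) j) \<le> (K1 * K2 * K) * (h1 * h2 * h) ^ j * assoc_w \<omega> lam' j" for j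
  proof -
    have "cmod (fps_nth F j) \<le> K1 * h1 ^ j * assoc_w \<omega> lam j"
      using K(3)[of j] assoc_w_mono[of l1 lam j] l K by (fastforce simp: lam_def intro: order_trans mult_left_mono)
    moreover have "cmod (fps_nth G j) \<le> K2 * h2 ^ j * assoc_w \<omega> lam j"
      using K(4)[of j] assoc_w_mono[of l2 lam j] l K by (fastforce simp: lam_def intro: order_trans mult_left_mono)
    ultimately have "cmod (fps_nth (fps_hadamard F G) j)
        \<le> (K1 * h1 ^ j * assoc_w \<omega> lam j) * (K2 * h2 ^ j * assoc_w \<omega> lam j)"
      unfolding fps_hadamard_def using K l less_imp_le[OF assoc_w_pos[of lam j]]
      by (simp add: norm_mult mult_mono)
    also have "\<dots> = K1 * K2 * (h1 * h2) ^ j * (assoc_w \<omega> lam j)\<^sup>2"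
      by (simp add: power_mult_distrib power2_eq_square)
    also have "\<dots> \<le> K1 * K2 * (h1 * h2) ^ j * (K * h ^ j * assoc_w \<omega> lam' j)"
      using P K l by (intro mult_left_mono) auto
    finally show ?thesis by (simp add: power_mult_distrib mult_ac)
  qed
  then have "fps_growth \<omega> lam' (h1 * h2 * h) (fps_hadamard F G)"
    using K P l by (subst fps_growth_iff) (auto intro!: exI[of _ "K1 * K2 * K"])
  moreover have "h1 * h2 * h > 0" using l P by simp
  ultimately show "fps_hadamard F G \<in> F_roumieu \<omega>"
    unfolding F_roumieu_def using P(1) by blast
qed

lemma hadamard_stable_beurling_if:
  assumes dom: "\<And>lam'. lam' > 0 \<Longrightarrow> \<exists>lam>0. square_dominated lam lam'"
  shows "hadamard_stable (F_beurling \<omega>)"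
  unfolding hadamard_stable_def
proof (intro ballI)
  fix F G assume FG: "F \<in> F_beurling \<omega>" "G \<in> F_beurling \<omega>"
  have "fps_growth \<omega> lam' h' (fps_hadamard F G)" if lh: "lam' > 0" "h' > 0" for lam' h'
  proof -
    obtain lam K h where P: "lam > 0" "K > 0" "h > 0"
      "\<And>j. (assoc_w \<omega> lam j)\<^sup>2 \<le> K * h ^ j * assoc_w \<omega> lam' j"
      using dom[OF lh(1)] unfolding square_dominated_def by blast
    \<comment> \<open>Both factors are taken with radius d; the product contributes d^2 and the
      domination h, which together must give h'.\<close>
    define d where "d = sqrt (h' / h)"
    have d: "d > 0" "d * d * h = h'" using P lh by (simp_all add: d_def)
    have "fps_growth \<omega> lam d F" "fps_growth \<omega> lam d G"
      using FG P(1) d(1) by (auto simp: F_beurling_def)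
    then obtain K1 K2 where K: "K1 > 0" "K2 > 0"
      "\<And>j. cmod (fps_nth F j) \<le> K1 * d ^ j * assoc_w \<omega> lam j"
      "\<And>j. cmod (fps_nth G j) \<le> K2 * d ^ j * assoc_w \<omega> lam j"
      unfolding fps_growth_iff[OF d(1)] by blast
    have "cmod (fps_nth (fps_hadamard F G) j) \<le> (K1 * K2 * K) * h' ^ j * assoc_w \<omega> lam' j" for j
    proof -
      have "cmod (fps_nth (fps_hadamard F G) j)
          \<le> (K1 * d ^ j * assoc_w \<omega> lam j) * (K2 * d ^ j * assoc_w \<omega> lam j)"
        unfolding fps_hadamard_def using K d less_imp_le[OF assoc_w_pos[of lam j]]
        by (simp add: norm_mult mult_mono)
      also have "\<dots> = K1 * K2 * (d * d) ^ j * (assoc_w \<omega> lam j)\<^sup>2"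
        by (simp add: power_mult_distrib power2_eq_square)
      also have "\<dots> \<le> K1 * K2 * (d * d) ^ j * (K * h ^ j * assoc_w \<omega> lam' j)"
        using P K d by (intro mult_left_mono) auto
      also have "\<dots> = (K1 * K2 * K) * (d * d * h) ^ j * assoc_w \<omega> lam' j"
        by (simp add: power_mult_distrib mult_ac)
      finally show ?thesis by (simp add: d(2))
    qed
    then show ?thesis
      using K P lh by (subst fps_growth_iff) (auto intro!: exI[of _ "K1 * K2 * K"])
  qed
  then show "fps_hadamard F G \<in> F_beurling \<omega>" unfolding F_beurling_def by blast
qed

text \<open>The series with coefficients \<open>assoc_w \<omega> 1 j\<close> is extremal in its row,
  so a growth bound for its Hadamard square is already a domination.\<close>

lemma hadamard_stable_roumieu_imp:
  assumes "hadamard_stable (F_roumieu \<omega>)"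
  shows "\<exists>lam'>0. square_dominated 1 lam'"
proof -
  define F where "F = Abs_fps (\<lambda>j. complex_of_real (assoc_w \<omega> 1 j))"
  have nF: "cmod (fps_nth F j) = assoc_w \<omega> 1 j" for j
    using assoc_w_pos[of 1 j] by (simp add: F_def)
  have "fps_growth \<omega> 1 1 F" by (subst fps_growth_iff) (auto simp: nF intro!: exI[of _ 1])
  then have "F \<in> F_roumieu \<omega>" unfolding F_roumieu_def using zero_less_one by blast
  then have "fps_hadamard F F \<in> F_roumieu \<omega>" using assms unfolding hadamard_stable_def by blast
  then obtain lam' h where lh: "lam' > 0" "h > 0" "fps_growth \<omega> lam' h (fps_hadamard F F)"
    unfolding F_roumieu_def by blast
  then obtain K where "K > 0" "\<And>j. (assoc_w \<omega> 1 j)\<^sup>2 \<le> K * h ^ j * assoc_w \<omega> lam' j"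
    by (auto simp: fps_growth_iff fps_hadamard_def norm_mult nF power2_eq_square)
  then show ?thesis using lh unfolding square_dominated_def by blast
qed

text \<open>Otherwise a lacunary series whose \<open>n\<close>-th nonzero coefficient is extremal for the parameters
  \<open>\<lambda> = h = 1/n\<close> lies in the Beurling space, but its Hadamard square does not.\<close>

lemma hadamard_stable_beurling_imp:
  assumes stable: "hadamard_stable (F_beurling \<omega>)"
  shows "\<exists>lam>0. square_dominated lam 1"
proof (rule ccontr)
  assume "\<not> ?thesis"
  then have no: "\<not> square_dominated lam 1" if "lam > 0" for lam using that by blast
  let ?w = "\<lambda>n j. assoc_w \<omega> (1 / real n) j"
  let ?c = "\<lambda>n j. ?w n j / real n ^ j"
  \<comment> \<open>If the lower bound failed for all j > m, the finitely many quotients up to m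
    could be absorbed into a constant, and \<open>square_dominated (1 / real n) 1\<close> would hold
    with h = n^2.\<close>
  have ex: "\<exists>j>m. (?c n j)\<^sup>2 > real n * assoc_w \<omega> 1 j" if n: "n > 0" for n m :: nat
  proof (rule ccontr)
    assume "\<not> ?thesis"
    then have le: "(?c n j)\<^sup>2 \<le> real n * assoc_w \<omega> 1 j" if "j > m" for j
      using that by (meson not_le)
    define K where "K = real n + (\<Sum>i\<le>m. (?c n i)\<^sup>2 / assoc_w \<omega> 1 i)"
    have K: "K > 0" unfolding K_def using n
      by (intro add_pos_nonneg sum_nonneg) auto
    have "(?c n j)\<^sup>2 \<le> K * assoc_w \<omega> 1 j" for j
    proof (cases "j > m")
      case True
      have "real n \<le> K" unfolding K_def using less_imp_le[OF assoc_w_pos] by (simp add: sum_nonneg)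
      then have "real n * assoc_w \<omega> 1 j \<le> K * assoc_w \<omega> 1 j"
        using less_imp_le[OF assoc_w_pos] by (intro mult_right_mono)
      then show ?thesis using le[OF True] by linarith
    next
      case False
      then have "(?c n j)\<^sup>2 / assoc_w \<omega> 1 j \<le> (\<Sum>i\<le>m. (?c n i)\<^sup>2 / assoc_w \<omega> 1 i)"
        by (intro member_le_sum) auto
      also have "\<dots> \<le> K" by (simp add: K_def)
      finally show ?thesis by (subst (asm) pos_divide_le_eq) auto
    qed
    then have "(?w n j)\<^sup>2 \<le> K * (real n ^ 2) ^ j * assoc_w \<omega> 1 j" for j
      using n by (simp add: power_divide field_simps flip: power_mult)
    moreover have "real n ^ 2 > 0" using n by simp
    ultimately have "square_dominated (1 / real n) 1"
      unfolding square_dominated_def using K by blast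
    then show False using no n by simp
  qed
  define step where "step n m = (SOME j. j > m \<and> (?c n j)\<^sup>2 > real n * assoc_w \<omega> 1 j)" for n m
  have step: "step n m > m" "(?c n (step n m))\<^sup>2 > real n * assoc_w \<omega> 1 (step n m)" if "n > 0" for n m
    using someI_ex[OF ex[OF that, of m]] by (auto simp: step_def)
  \<comment> \<open>Strict growth makes \<open>idx\<close> injective, so \<open>THE\<close> in F
    below is unambiguous. The value \<open>idx 0\<close> only starts the recursion; coefficients are
    placed at \<open>idx n\<close> with n > 0.\<close>
  define idx where "idx = rec_nat 0 (\<lambda>n m. step (Suc n) m)"
  have idx_Suc: "idx (Suc n) = step (Suc n) (idx n)" for n by (simp add: idx_def)
  have "strict_mono idx" unfolding strict_mono_Suc_iff idx_Suc using step(1) by simp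
  then have inj: "idx m = idx n \<longleftrightarrow> m = n" for m n by (simp add: strict_mono_eq)
  have big: "(?c n (idx n))\<^sup>2 > real n * assoc_w \<omega> 1 (idx n)" if n: "n > 0" for n
  proof -
    obtain m where "n = Suc m" using n by (cases n) auto
    then show ?thesis using step(2)[of "Suc m" "idx m"] by (simp only: idx_Suc zero_less_Suc)
  qed
  define F where "F = Abs_fps (\<lambda>j. if \<exists>n>0. j = idx n
    then complex_of_real (?c (THE n. j = idx n) j) else 0)"
  have F_idx: "fps_nth F (idx n) = complex_of_real (?c n (idx n))" if "n > 0" for n
    using that inj by (auto simp: F_def)
  have F_0: "fps_nth F j = 0" if "\<nexists>n. n > 0 \<and> j = idx n" for j
    using that by (simp only: F_def fps_nth_Abs_fps if_False)
  have cpos: "?c n j \<ge> 0" for n j using less_imp_le[OF assoc_w_pos] by simp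
  have "fps_growth \<omega> lam h F" if lh: "lam > 0" "h > 0" for lam h
  proof -
    \<comment> \<open>For n > N the parameter 1/n lies below both \<open>lam\<close> and h; the
      coefficients up to \<open>idx N\<close> go into the constant K.\<close>
    obtain N :: nat where N: "N > 0" "1 / real N < lam" "1 / real N < h"
    proof -
      obtain N :: nat where "N > 0" "inverse (real N) < min lam h"
        using ex_inverse_of_nat_less[of "min lam h"] lh by auto
      then show ?thesis using that by (auto simp: inverse_eq_divide)
    qed
    define K where "K = 1 + (\<Sum>i\<le>idx N. cmod (fps_nth F i) / (h ^ i * assoc_w \<omega> lam i))"
    have K: "K \<ge> 1" unfolding K_def using lh less_imp_le[OF assoc_w_pos] by (simp add: sum_nonneg)
    have "cmod (fps_nth F j) \<le> K * h ^ j * assoc_w \<omega> lam j" for j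
    proof (cases "j \<le> idx N")
      case True
      then have "cmod (fps_nth F j) / (h ^ j * assoc_w \<omega> lam j)
          \<le> (\<Sum>i\<le>idx N. cmod (fps_nth F i) / (h ^ i * assoc_w \<omega> lam i))"
        using lh by (intro member_le_sum) auto
      also have "\<dots> \<le> K" by (simp add: K_def)
      finally show ?thesis using assoc_w_pos[of lam j] lh by (simp add: field_simps)
    next
      case False
      have hw: "0 \<le> h ^ j * assoc_w \<omega> lam j" using lh less_imp_le[OF assoc_w_pos] by simp
      show ?thesis
      proof (cases "\<exists>n>0. j = idx n")
        case True
        then obtain n where n: "n > 0" "j = idx n" by blast
        with False \<open>strict_mono idx\<close> have nN: "n > N"
          by (simp add: strict_mono_less_eq not_le)
        have inv: "1 / real n \<le> 1 / real N" using nN N by (simp add: frac_le)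
        have "cmod (fps_nth F j) = ?c n j" using F_idx[OF n(1)] n(2) cpos[of n j] by (simp add: norm_divide norm_power)
        also have "\<dots> = (1 / real n) ^ j * ?w n j" by (simp add: power_divide)
        also have "\<dots> \<le> h ^ j * assoc_w \<omega> lam j"
          using inv N n lh by (intro mult_mono power_mono assoc_w_mono less_imp_le[OF assoc_w_pos]) auto
        also have "\<dots> \<le> K * (h ^ j * assoc_w \<omega> lam j)"
          using mult_right_mono[OF K hw] by simp
        finally show ?thesis by (simp add: mult.assoc)
      next
        case no_idx: False
        have "0 \<le> K * (h ^ j * assoc_w \<omega> lam j)" using K by (intro mult_nonneg_nonneg hw) simp
        then show ?thesis using F_0 no_idx by (simp add: mult.assoc)
      qed
    qed
    then show ?thesis using K lh by (subst fps_growth_iff) (auto intro!: exI[of _ K])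
  qed
  then have "F \<in> F_beurling \<omega>" by (simp add: F_beurling_def)
  then have "fps_hadamard F F \<in> F_beurling \<omega>" using stable unfolding hadamard_stable_def by blast
  then have "fps_growth \<omega> 1 1 (fps_hadamard F F)" by (simp add: F_beurling_def)
  then obtain K where K: "\<And>j. (cmod (fps_nth F j))\<^sup>2 \<le> K * assoc_w \<omega> 1 j"
    by (auto simp: fps_growth_iff fps_hadamard_def norm_mult power2_eq_square)
  \<comment> \<open>The excess at \<open>idx n\<close> exceeds the factor n, so any n above K gives
    a contradiction.\<close>
  obtain n :: nat where n: "real n > max K 0" using reals_Archimedean2 by blast
  then have "n > 0" by simp
  have "(?c n (idx n))\<^sup>2 \<le> K * assoc_w \<omega> 1 (idx n)"
    using K[of "idx n"] F_idx[OF \<open>n > 0\<close>] cpos[of n "idx n"]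
    by (simp only: norm_of_real power2_abs)
  also have "\<dots> \<le> real n * assoc_w \<omega> 1 (idx n)"
    using n less_imp_le[OF assoc_w_pos] by (intro mult_right_mono) auto
  finally show False using big[OF \<open>n > 0\<close>] by simp
qed

section \<open>Convex duality and recovery of the condition\<close>

text \<open>Compactness of [1, b'] suffices: the value at 1 is s, while s / t >= s for t < 1 and
  \<omega> t / lam >= s beyond b'.\<close>

lemma weight_minimizer:
  assumes s: "s > 0" and lam: "lam > 0"
  obtains r where "r \<ge> 1" "\<And>t. t > 0 \<Longrightarrow> \<omega> r / lam + s / r \<le> \<omega> t / lam + s / t"
proof -
  let ?f = "\<lambda>t. \<omega> t / lam + s / t"
  have "eventually (\<lambda>t. \<omega> t \<ge> lam * s) at_top" using weight_at_top unfolding filterlim_at_top by blast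
  then obtain b where b: "\<And>t. t \<ge> b \<Longrightarrow> \<omega> t \<ge> lam * s" by (auto simp: eventually_at_top_linorder)
  define b' where "b' = max 1 b"
  have "continuous_on {1..b'} ?f"
    by (intro continuous_intros continuous_on_subset[OF weight_cont]) (use lam in auto)
  then obtain r where r: "r \<in> {1..b'}" "\<And>t. t \<in> {1..b'} \<Longrightarrow> ?f r \<le> ?f t"
    using continuous_attains_inf[of "{1..b'}" ?f] by (auto simp: b'_def)
  have f1: "?f r \<le> s" using r(2)[of 1] weight_eq_0[of 1] by (simp add: b'_def)
  show ?thesis
  proof (rule that[of r])
    fix t :: real assume t: "t > 0"
    consider "t < 1" | "t \<in> {1..b'}" | "t > b'" by fastforce
    then show "?f r \<le> ?f t"
    proof cases
      case 1
      then have "s \<le> s / t" using t s by (simp add: field_simps)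
      then show ?thesis using f1 weight_eq_0[of t] t 1 by simp
    next
      case 3
      then have "s \<le> \<omega> t / lam" using b[of t] lam by (simp add: b'_def field_simps)
      moreover have "0 \<le> s / t" using s t by simp
      ultimately show ?thesis using f1 by linarith
    qed (use r in auto)
  qed (use r in auto)
qed

text \<open>First-order optimality at a minimizer of \<open>\<phi>(y)/\<lambda> + s exp (- y)\<close>: the convex function \<open>\<phi>/\<lambda>\<close>
  has the subgradient \<open>s/r\<close> at \<open>ln r\<close>.\<close>

lemma weight_tangent:
  assumes conv: "convex_on UNIV (weight_phi \<omega>)" and lam: "lam > 0" and r: "r > 0"
    and min: "\<And>t. t > 0 \<Longrightarrow> \<omega> r / lam + s / r \<le> \<omega> t / lam + s / t"
    and t: "t > 0"
  shows "\<omega> r / lam + s / r * (ln t - ln r) \<le> \<omega> t / lam"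
proof -
  define d where "d = ln t - ln r"
  \<comment> \<open>Convexity at the fraction \<theta> of the segment from ln r to ln t is compared
    with minimality at r. Division by \<theta> leaves a difference quotient, whose limit at 0 is
    d.\<close>
  have step: "s / r * ((1 - exp (- \<theta> * d)) / \<theta>) \<le> (\<omega> t - \<omega> r) / lam" if \<theta>: "0 < \<theta>" "\<theta> < 1" for \<theta>
  proof -
    define u where "u = exp (ln r + \<theta> * d)"
    have u: "u > 0" "s / u = s / r * exp (- \<theta> * d)"
      using r by (simp_all add: u_def exp_add exp_minus field_simps)
    have "weight_phi \<omega> ((1 - \<theta>) *\<^sub>R ln r + \<theta> *\<^sub>R ln t)
        \<le> (1 - \<theta>) * weight_phi \<omega> (ln r) + \<theta> * weight_phi \<omega> (ln t)"
      using \<theta> by (intro convex_onD[OF conv]) auto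
    moreover have "(1 - \<theta>) *\<^sub>R ln r + \<theta> *\<^sub>R ln t = ln r + \<theta> * d" by (simp add: d_def algebra_simps)
    ultimately have "\<omega> u \<le> (1 - \<theta>) * \<omega> r + \<theta> * \<omega> t" using r t by (simp add: weight_phi_def u_def)
    then have "\<omega> u - \<omega> r \<le> \<theta> * (\<omega> t - \<omega> r)" by (simp add: algebra_simps)
    then have "(\<omega> u - \<omega> r) / lam \<le> \<theta> * (\<omega> t - \<omega> r) / lam" using lam by (simp add: divide_right_mono)
    moreover have "s / r - s / u \<le> (\<omega> u - \<omega> r) / lam" using min[OF u(1)] by (simp add: diff_divide_distrib)
    ultimately have "s / r * (1 - exp (- \<theta> * d)) \<le> \<theta> * ((\<omega> t - \<omega> r) / lam)"
      using u(2) by (simp add: algebra_simps)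
    then have "s / r * (1 - exp (- \<theta> * d)) / \<theta> \<le> (\<omega> t - \<omega> r) / lam"
      using \<theta> by (simp only: pos_divide_le_eq mult.commute[of _ \<theta>])
    then show ?thesis by simp
  qed
  have "((\<lambda>\<theta>. 1 - exp (- \<theta> * d)) has_real_derivative d) (at 0)"
    by (auto intro!: derivative_eq_intros)
  then have "((\<lambda>\<theta>. (1 - exp (- \<theta> * d)) / \<theta>) \<longlongrightarrow> d) (at_right 0)"
    by (simp add: DERIV_def filterlim_at_split)
  then have "((\<lambda>\<theta>. s / r * ((1 - exp (- \<theta> * d)) / \<theta>)) \<longlongrightarrow> s / r * d) (at_right 0)"
    by (intro tendsto_intros)
  moreover have "eventually (\<lambda>\<theta>. s / r * ((1 - exp (- \<theta> * d)) / \<theta>) \<le> (\<omega> t - \<omega> r) / lam) (at_right 0)"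
    by (rule eventually_at_rightI[of 0 1]) (use step in auto)
  ultimately have "s / r * d \<le> (\<omega> t - \<omega> r) / lam"
    by (rule tendsto_upperbound) simp
  then show ?thesis by (simp add: d_def diff_divide_distrib)
qed

text \<open>A discrete form of the duality between \<open>j! W\<^sub>j\<close> and the infimal convolution defining the lower
  Legendre conjugate: \<open>r\<close> is the minimizer of \<open>\<omega>(r)/\<lambda> + s/r\<close> and \<open>n\<close> the integer part of \<open>s/r\<close>.\<close>

lemma fact_assoc_W_duality:
  assumes conv: "convex_on UNIV (weight_phi \<omega>)" and lam: "lam > 0"
  obtains D where "D \<ge> 0"
    "\<And>s. s > 0 \<Longrightarrow> \<exists>r>0. \<exists>n. fact n * assoc_W \<omega> lam n * exp ((\<omega> r / lam + s / r) / 2 - D) \<le> s ^ n"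
proof -
  obtain T where T: "T \<ge> 1" "\<And>t. t \<ge> T \<Longrightarrow> lam * ln t \<le> \<omega> t"
    using weight_ge_ln[of lam] by blast
  define D where "D = 2 + \<omega> T / lam"
  have D: "D \<ge> 2" using T(1) lam weight_nonneg[of T] by (simp add: D_def)
  show ?thesis
  proof (rule that)
    show "D \<ge> 0" using D by simp
    fix s :: real assume s: "s > 0"
    obtain r where r: "r \<ge> 1" "\<And>t. t > 0 \<Longrightarrow> \<omega> r / lam + s / r \<le> \<omega> t / lam + s / t"
      using weight_minimizer[OF s lam] by blast
    define j where "j = s / r"
    have j: "j > 0" "s = r * j" using r(1) s by (simp_all add: j_def)
    have tangent: "\<omega> r / lam + j * (ln t - ln r) \<le> \<omega> t / lam" if "t > 0" for t
      unfolding j_def using weight_tangent[OF conv lam _ r(2) that] r(1) by simp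
    have r0: "\<omega> r / lam \<ge> 0" using r(1) lam weight_nonneg[of r] by simp
    have "\<exists>n. fact n * assoc_W \<omega> lam n * exp ((\<omega> r / lam + j) / 2 - D) \<le> s ^ n"
    proof (cases "j < 1")
      case True
      \<comment> \<open>For a slope j < 1 the tangent at t = 1 gives \<omega> r / lam < ln r,
        impossible beyond T. Hence the exponent is bounded by means of D, and n = 0 works.\<close>
      have "r \<le> T"
      proof (rule ccontr)
        assume "\<not> r \<le> T"
        then have rT: "r > T" "ln r > 0" using T(1) by auto
        have "\<omega> r / lam \<le> j * ln r" using tangent[of 1] weight_eq_0[of 1] by simp
        also have "\<dots> < ln r" using True rT by simp
        also have "\<dots> \<le> \<omega> r / lam" using T(2)[of r] rT lam by (simp add: field_simps)
        finally show False by simp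
      qed
      then have "\<omega> r / lam \<le> \<omega> T / lam" using weight_mono[of r T] r(1) lam by (simp add: divide_right_mono)
      moreover have "2 * D = 4 + 2 * (\<omega> T / lam)" by (simp add: D_def)
      ultimately have "\<omega> r / lam + j \<le> 2 * D" using True r0 by linarith
      then have "(\<omega> r / lam + j) / 2 - D \<le> 0" by simp
      moreover have "assoc_W \<omega> lam 0 \<le> 1"
        by (rule assoc_W_le[OF lam]) (use lam weight_nonneg in simp)
      ultimately have "assoc_W \<omega> lam 0 * exp ((\<omega> r / lam + j) / 2 - D) \<le> 1 * 1"
        by (intro mult_mono) auto
      then show ?thesis by (intro exI[of _ 0]) simp
    next
      case False
      define n where "n = nat \<lfloor>j\<rfloor>"
      have n: "real n \<le> j" "j < real n + 1" "real n \<ge> 1"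
        using False by (simp_all add: n_def)
      have nj: "1 / 2 \<le> real n / j" "real n / j \<le> 1" using n j by (simp_all add: field_simps)
      \<comment> \<open>Multiplying the tangent inequality by n / j, which lies between 1/2 and 1,
        turns the slope j into the integer n and still keeps half of \<omega> r / lam.\<close>
      have "assoc_W \<omega> lam n \<le> r ^ n * exp (- (\<omega> r / lam) / 2)"
      proof (rule assoc_W_le[OF lam])
        fix t :: real assume t: "t \<ge> 1"
        have "real n / j * (\<omega> r / lam + j * (ln t - ln r)) \<le> real n / j * (\<omega> t / lam)"
          using tangent[of t] t j by (intro mult_left_mono) auto
        also have "\<dots> \<le> 1 * (\<omega> t / lam)"
          using nj(2) lam weight_nonneg[of t] t by (intro mult_right_mono) auto
        finally have "real n / j * (\<omega> r / lam) + real n * (ln t - ln r) \<le> \<omega> t / lam"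
          using j by (simp add: algebra_simps)
        moreover have "1 / 2 * (\<omega> r / lam) \<le> real n / j * (\<omega> r / lam)"
          using nj(1) r0 by (rule mult_right_mono)
        ultimately have "real n * ln t - \<omega> t / lam \<le> real n * ln r - (\<omega> r / lam) / 2"
          by (simp add: algebra_simps)
        then have "exp (real n * ln t + (- \<omega> t / lam)) \<le> exp (real n * ln r + (- (\<omega> r / lam) / 2))" by simp
        then show "t ^ n * exp (- \<omega> t / lam) \<le> r ^ n * exp (- (\<omega> r / lam) / 2)"
          unfolding exp_add using t r(1) by (simp add: exp_of_nat_mult)
      qed
      then have "fact n * assoc_W \<omega> lam n * exp ((\<omega> r / lam + j) / 2 - D)
          \<le> fact n * (r ^ n * exp (- (\<omega> r / lam) / 2)) * exp ((\<omega> r / lam + j) / 2 - D)"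
        by (intro mult_right_mono mult_left_mono) auto
      also have "\<dots> = r ^ n * (fact n * (exp (- (\<omega> r / lam) / 2) * exp ((\<omega> r / lam + j) / 2 - D)))"
        by (simp only: mult_ac)
      also have "exp (- (\<omega> r / lam) / 2) * exp ((\<omega> r / lam + j) / 2 - D) = exp (j / 2 - D)"
        by (simp add: mult_exp_exp add_divide_distrib)
      \<comment> \<open>Uses j < n + 1 and D >= 2. The resulting factor 2^n / 2 is exactly what
        \<open>fact_mult_2_power_le\<close> compensates.\<close>
      also have "exp (j / 2 - D) \<le> exp (real n * (1 / 2) + - (3 / 2))"
        using n(2) D by simp
      also have "\<dots> = exp (1 / 2) ^ n * exp (- (3 / 2))"
        by (simp only: exp_add exp_of_nat_mult)
      also have "\<dots> \<le> 2 ^ n * (1 / 2)"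
      proof (intro mult_mono power_mono)
        show "exp (1 / 2) \<le> (2 :: real)" using exp_ge_add_one_self[of "- 1 / 2 :: real"] by (simp add: exp_minus field_simps)
        show "exp (- (3 / 2)) \<le> (1 / 2 :: real)" using exp_ge_add_one_self[of "3 / 2 :: real"] by (simp add: exp_minus field_simps)
      qed auto
      also have "fact n * (2 ^ n * (1 / 2)) \<le> real n ^ n" using fact_mult_2_power_le[of n] by simp
      also have "real n ^ n \<le> j ^ n" using n by (intro power_mono) auto
      also have "r ^ n * j ^ n = s ^ n" by (simp add: j(2) power_mult_distrib)
      finally show ?thesis using r(1) by (auto simp: mult_left_mono)
    qed
    then show "\<exists>r>0. \<exists>n. fact n * assoc_W \<omega> lam n * exp ((\<omega> r / lam + s / r) / 2 - D) \<le> s ^ n"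
      using r(1) unfolding j_def by (intro exI[of _ r]) auto
  qed
qed

text \<open>With h \<tau>^2 = t^2, the duality at s = \<tau>^2 makes the powers of t cancel. What
  remains bounds \<omega> r / lam' + \<tau>^2 / r linearly in \<omega> t, and r is a competitor in
  the infimum.\<close>

lemma square_dominated_imp_iota_star_condition:
  assumes conv: "convex_on UNIV (weight_phi \<omega>)" and lam: "lam > 0" "lam' > 0"
    and dom: "square_dominated lam lam'"
  shows "iota_star_condition \<omega>"
proof -
  obtain K h where Kh: "K > 0" "h > 0"
    "\<And>j. (assoc_W \<omega> lam j)\<^sup>2 \<le> K * h ^ j * fact j * assoc_W \<omega> lam' j"
    using square_dominatedE[OF dom] by blast
  obtain D where D: "D \<ge> 0"
    "\<And>s. s > 0 \<Longrightarrow> \<exists>r>0. \<exists>n. fact n * assoc_W \<omega> lam' n * exp ((\<omega> r / lam' + s / r) / 2 - D) \<le> s ^ n"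
    using fact_assoc_W_duality[OF conv lam(2)] by blast
  define B where "B = 2 * (lam' + 1)"
  have B: "B > 0" using lam by (simp add: B_def)
  \<comment> \<open>The summands provide the coefficient of \<omega> t, the additive constant, and
    the bound for \<tau>^2 when \<open>sqrt h * \<tau> < 1\<close>.\<close>
  define C where "C = B * (2 / lam) + B * (\<bar>ln K\<bar> + D) + 1 / h"
  have "B * (2 / lam) > 0" "B * (\<bar>ln K\<bar> + D) \<ge> 0" "1 / h > 0" using B D lam Kh by auto
  then have C: "C > 0" "C \<ge> B * (2 / lam)" "C \<ge> B * (\<bar>ln K\<bar> + D)" "C \<ge> 1 / h"
    unfolding C_def by linarith+
  have "lower_legendre (weight_iota \<omega>) (\<tau>\<^sup>2) \<le> C * \<omega> (sqrt h * \<tau>) + C" if \<tau>: "\<tau> \<ge> 0" for \<tau>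
  proof (cases "sqrt h * \<tau> < 1")
    case True
    then have "(sqrt h * \<tau>)\<^sup>2 \<le> 1" using \<tau> Kh by (intro power_le_one) auto
    then have "\<tau>\<^sup>2 \<le> 1 / h" using Kh by (simp add: power_mult_distrib field_simps)
    moreover have "lower_legendre (weight_iota \<omega>) (\<tau>\<^sup>2) \<le> \<tau>\<^sup>2"
      using lower_legendre_le[of "\<tau>\<^sup>2" 1] weight_eq_0[of 1] by simp
    moreover have "C * \<omega> (sqrt h * \<tau>) \<ge> 0" using C \<tau> Kh weight_nonneg[of "sqrt h * \<tau>"] by simp
    ultimately show ?thesis using C(4) by linarith
  next
    case False
    define t where "t = sqrt h * \<tau>"
    have t: "t \<ge> 1" "h * \<tau>\<^sup>2 = t\<^sup>2" using False Kh by (simp_all add: t_def power_mult_distrib)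
    then have "\<tau> \<noteq> 0" by auto
    then obtain r n where rn: "r > 0"
      "fact n * assoc_W \<omega> lam' n * exp ((\<omega> r / lam' + \<tau>\<^sup>2 / r) / 2 - D) \<le> (\<tau>\<^sup>2) ^ n"
      using D(2)[of "\<tau>\<^sup>2"] by auto
    define m where "m = \<omega> r / lam' + \<tau>\<^sup>2 / r"
    have "(t ^ n * exp (- \<omega> t / lam))\<^sup>2 \<le> (assoc_W \<omega> lam n)\<^sup>2"
      using t lam by (intro power_mono assoc_W_ge) auto
    also have "\<dots> \<le> K * h ^ n * (fact n * assoc_W \<omega> lam' n)" using Kh(3)[of n] by (simp add: mult.assoc)
    also have "\<dots> \<le> K * h ^ n * ((\<tau>\<^sup>2) ^ n * exp (D - m / 2))"
    proof (rule mult_left_mono)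
      have "fact n * assoc_W \<omega> lam' n
          = fact n * assoc_W \<omega> lam' n * exp (m / 2 - D) * exp (D - m / 2)"
        by (simp add: mult.assoc mult_exp_exp)
      also have "\<dots> \<le> (\<tau>\<^sup>2) ^ n * exp (D - m / 2)"
        using rn(2) unfolding m_def by (rule mult_right_mono) simp
      finally show "fact n * assoc_W \<omega> lam' n \<le> (\<tau>\<^sup>2) ^ n * exp (D - m / 2)" .
    qed (use Kh in simp)
    also have "\<dots> = K * (h * \<tau>\<^sup>2) ^ n * exp (D - m / 2)" by (simp add: power_mult_distrib)
    also have "\<dots> = (t ^ n)\<^sup>2 * (K * exp (D - m / 2))" by (simp add: t(2) mult.commute flip: power_mult)
    finally have "(exp (- \<omega> t / lam))\<^sup>2 \<le> K * exp (D - m / 2)"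
      using t(1) by (simp add: power_mult_distrib)
    then have "exp (2 * (- \<omega> t / lam)) \<le> exp (ln K + (D - m / 2))"
      using Kh(1) by (simp only: exp_double exp_add exp_ln)
    then have m: "m \<le> 2 * (2 / lam * \<omega> t + \<bar>ln K\<bar> + D)" by simp
    have "\<omega> r + \<tau>\<^sup>2 / r \<le> (lam' + 1) * m"
    proof -
      have "(lam' + 1) * m = \<omega> r + \<omega> r / lam' + lam' * (\<tau>\<^sup>2 / r) + \<tau>\<^sup>2 / r"
        using lam by (simp add: m_def algebra_simps add_divide_distrib)
      moreover have "\<omega> r / lam' \<ge> 0" "lam' * (\<tau>\<^sup>2 / r) \<ge> 0" using rn(1) lam weight_nonneg[of r] by auto
      ultimately show ?thesis by linarith
    qed
    also have "\<dots> \<le> (lam' + 1) * (2 * (2 / lam * \<omega> t + \<bar>ln K\<bar> + D))"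
      using m lam by (intro mult_left_mono) auto
    also have "\<dots> = B * (2 / lam) * \<omega> t + B * (\<bar>ln K\<bar> + D)" by (simp add: B_def algebra_simps add_divide_distrib)
    also have "\<dots> \<le> C * \<omega> t + C" using C t weight_nonneg[of t] by (intro add_mono mult_right_mono) auto
    finally show ?thesis
      using lower_legendre_le[of "\<tau>\<^sup>2" r] rn(1) by (simp add: t_def)
  qed
  then show ?thesis unfolding iota_star_condition_def using C(1) Kh(2)
    by (intro exI[of _ "sqrt h"] conjI exI[of _ C]) auto
qed

section \<open>Square-root growth and convergence of the integral\<close>

lemma iota_star_condition_sqrt_bound:
  assumes cond: "iota_star_condition \<omega>"
    and liminf: "Liminf at_top (\<lambda>t. ereal (\<omega> t / t)) = 0"
  obtains K where "K \<ge> 0" "\<And>t. t \<ge> 1 \<Longrightarrow> \<omega> t \<le> K * sqrt t"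
proof -
  obtain H C where HC: "H > 0" "C \<ge> 1"
    "\<And>t. t > 0 \<Longrightarrow> \<exists>r>0. \<omega> r + t\<^sup>2 / (H\<^sup>2 * r) \<le> C * \<omega> t + C"
    using iota_star_conditionE[OF cond] by metis
  \<comment> \<open>Scaling the argument by A costs the factor 2 C, the square root of A, which
    yields the exponent 1/2. With this \<delta>, inserting \<omega> t <= \<delta> t into the
    condition gives A t <= r.\<close>
  define A where "A = (2 * C)\<^sup>2"
  define \<delta> where "\<delta> = 1 / (2 * C * H\<^sup>2 * A)"
  have C: "2 * C > 1" using HC(2) by simp
  then have A: "A > 1" unfolding A_def by (rule one_less_power) simp
  have \<delta>: "\<delta> > 0" using HC A by (simp add: \<delta>_def)
  have "eventually (\<lambda>t. \<omega> t \<ge> 1) at_top" using weight_at_top unfolding filterlim_at_top by blast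
  then obtain T0 where T0: "\<And>t. t \<ge> T0 \<Longrightarrow> \<omega> t \<ge> 1" by (auto simp: eventually_at_top_linorder)
  define T where "T = max 1 T0"
  have T: "T \<ge> 1" "\<And>t. t \<ge> T \<Longrightarrow> \<omega> t \<ge> 1" using T0 by (auto simp: T_def)
  have growth: "\<omega> (A * t) \<le> 2 * C * \<omega> t" if t: "t \<ge> T" "\<omega> t \<le> \<delta> * t" for t
  proof -
    have w: "\<omega> t \<ge> 1" and t0: "t > 0" using T t by force+
    obtain r where r: "r > 0" "\<omega> r + t\<^sup>2 / (H\<^sup>2 * r) \<le> C * \<omega> t + C" using HC(3)[OF t0] by blast
    have "C * 1 \<le> C * \<omega> t" using w HC(2) by (intro mult_left_mono) auto
    then have le: "\<omega> r + t\<^sup>2 / (H\<^sup>2 * r) \<le> 2 * C * \<omega> t" using r(2) by linarith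
    moreover have "\<omega> r \<ge> 0" "t\<^sup>2 / (H\<^sup>2 * r) \<ge> 0" using r weight_nonneg[of r] by auto
    ultimately have "\<omega> r \<le> 2 * C * \<omega> t" "t\<^sup>2 / (H\<^sup>2 * r) \<le> 2 * C * \<omega> t" by linarith+
    have "t\<^sup>2 \<le> 2 * C * \<omega> t * (H\<^sup>2 * r)"
      using \<open>t\<^sup>2 / (H\<^sup>2 * r) \<le> 2 * C * \<omega> t\<close> r(1) HC(1) by (simp add: pos_divide_le_eq)
    also have "\<dots> \<le> 2 * C * (\<delta> * t) * (H\<^sup>2 * r)"
      using t(2) r(1) HC by (intro mult_right_mono mult_left_mono) auto
    also have "\<dots> = r * t / A" using HC A by (simp add: \<delta>_def)
    finally have "A * t \<le> r" using A t0 by (simp add: field_simps power2_eq_square)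
    then have "\<omega> (A * t) \<le> \<omega> r" using A t0 by (intro weight_mono) auto
    with \<open>\<omega> r \<le> 2 * C * \<omega> t\<close> show ?thesis by linarith
  qed
  obtain t0 where t0: "t0 \<ge> T" "\<omega> t0 \<le> \<delta> * t0"
  proof (rule ccontr)
    assume "\<not> thesis"
    then have "\<omega> t > \<delta> * t" if "t \<ge> T" for t using that \<open>\<And>t0. \<lbrakk>t0 \<ge> T; \<omega> t0 \<le> \<delta> * t0\<rbrakk> \<Longrightarrow> thesis\<close> by force
    then have "ereal \<delta> \<le> ereal (\<omega> t / t)" if "t \<ge> T" for t
      using that T(1) by (force simp: field_simps intro: less_imp_le)
    then have "eventually (\<lambda>t. ereal \<delta> \<le> ereal (\<omega> t / t)) at_top"
      unfolding eventually_at_top_linorder by blast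
    from Liminf_bounded[OF this] show False using liminf \<delta> by simp
  qed
  have t0_pos: "t0 \<ge> 1" "\<omega> t0 \<ge> 1" using t0 T by force+
  have iter: "\<omega> (A ^ k * t0) \<le> (2 * C) ^ k * \<omega> t0" for k
  proof (induction k)
    case (Suc k)
    \<comment> \<open>The ratio \<omega> t / t stays below \<delta>, because the bound on the weight
      grows by 2 C per step and the argument by A >= 2 C.\<close>
    have "2 * C \<le> A" unfolding A_def using C by (intro self_le_power) auto
    then have "(2 * C) ^ k \<le> A ^ k" using HC(2) by (intro power_mono) auto
    then have "(2 * C) ^ k * \<omega> t0 \<le> A ^ k * (\<delta> * t0)"
      using t0 t0_pos A HC by (intro mult_mono) auto
    then have "\<omega> (A ^ k * t0) \<le> \<delta> * (A ^ k * t0)" using Suc by (simp add: mult_ac)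
    moreover have "T \<le> A ^ k * t0" using t0(1) t0_pos A mult_mono[of 1 "A ^ k" T t0] T(1) by simp
    ultimately have "\<omega> (A * (A ^ k * t0)) \<le> 2 * C * \<omega> (A ^ k * t0)" by (intro growth)
    also have "\<dots> \<le> 2 * C * ((2 * C) ^ k * \<omega> t0)" using Suc HC(2) by (intro mult_left_mono) auto
    finally show ?case by (simp add: mult_ac)
  qed simp
  \<comment> \<open>The factor 2 C pays for rounding t up to the next point
    \<open>A ^ Suc k * t0\<close>, since sqrt t controls only \<open>(2 * C) ^ k\<close>.\<close>
  define K where "K = 2 * C * \<omega> t0"
  have K: "K \<ge> \<omega> t0" "K \<ge> 0" using C t0_pos by (simp_all add: K_def)
  show ?thesis
  proof (rule that[OF K(2)])
    fix t :: real assume t: "t \<ge> 1"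
    have sq: "sqrt t \<ge> 1" using t by simp
    show "\<omega> t \<le> K * sqrt t"
    proof (cases "t \<le> t0")
      case True
      then have "\<omega> t \<le> K * 1" using weight_mono[of t t0] t K by simp
      also have "\<dots> \<le> K * sqrt t" using sq K by (intro mult_left_mono) auto
      finally show ?thesis .
    next
      case False
      have ex: "\<exists>n. t < A ^ n * t0"
      proof -
        obtain n where "t < A ^ n" using real_arch_pow[OF A] by blast
        moreover have "A ^ n * 1 \<le> A ^ n * t0" using t0_pos A by (intro mult_left_mono) auto
        ultimately show ?thesis by (intro exI[of _ n]) linarith
      qed
      define n where "n = (LEAST n. t < A ^ n * t0)"
      have n: "t < A ^ n * t0" unfolding n_def using LeastI_ex[OF ex] .
      then obtain k where k: "n = Suc k" using False by (cases n) auto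
      have "\<not> t < A ^ k * t0" using not_less_Least[of k "\<lambda>n. t < A ^ n * t0"] k n_def by simp
      moreover have "A ^ k * 1 \<le> A ^ k * t0" using t0_pos A by (intro mult_left_mono) auto
      ultimately have "A ^ k \<le> t" by linarith
      then have "((2 * C) ^ k)\<^sup>2 \<le> t"
        unfolding A_def by (simp only: power_mult[symmetric] mult.commute)
      then have Ck: "(2 * C) ^ k \<le> sqrt t" by (rule real_le_rsqrt)
      have "\<omega> t \<le> \<omega> (A ^ n * t0)" using n t by (intro weight_mono) auto
      also have "\<dots> \<le> (2 * C) ^ n * \<omega> t0" by (rule iter)
      also have "\<dots> = K * (2 * C) ^ k" by (simp add: k K_def)
      also have "\<dots> \<le> K * sqrt t" using Ck K by (intro mult_left_mono)
      finally show ?thesis .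
    qed
  qed
qed

text \<open>Comparison with K t^(-3/2), whose antiderivative -2 K / sqrt t vanishes at
  infinity.\<close>

lemma nonquasianalytic_if_sqrt_bound:
  assumes K: "K \<ge> 0" "\<And>t. t \<ge> 1 \<Longrightarrow> \<omega> t \<le> K * sqrt t"
  shows "nonquasianalytic \<omega>"
proof -
  let ?f = "\<lambda>t. K / (t * sqrt t)"
  have "(\<integral>\<^sup>+ t\<in>{1..}. ennreal (\<omega> t / t\<^sup>2) \<partial>lborel) \<le> (\<integral>\<^sup>+ t\<in>{1..}. ennreal (?f t) \<partial>lborel)"
  proof (intro nn_integral_mono)
    fix t :: real
    show "ennreal (\<omega> t / t\<^sup>2) * indicator {1..} t \<le> ennreal (?f t) * indicator {1..} t"
    proof (cases "t \<ge> 1")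
      case True
      have "K * u / (u * u)\<^sup>2 = K / (u * u * u)" if "u > 0" for u
        using that by (simp add: power2_eq_square)
      from this[of "sqrt t"] have eq: "K * sqrt t / t\<^sup>2 = ?f t" using True by simp
      have "\<omega> t / t\<^sup>2 \<le> K * sqrt t / t\<^sup>2" using K(2)[OF True] by (simp add: divide_right_mono)
      then show ?thesis unfolding eq by (simp add: ennreal_leI mult_right_mono)
    qed simp
  qed
  also have "\<dots> = ennreal (0 - (- 2 * K / sqrt 1))"
  proof (rule nn_integral_FTC_atLeast)
    show "?f \<in> borel_measurable borel" by measurable
    fix x :: real assume x: "1 \<le> x"
    show "DERIV (\<lambda>x. - 2 * K / sqrt x) x :> ?f x"
      using x by (auto intro!: derivative_eq_intros simp: field_simps)
    show "0 \<le> ?f x" using x K by simp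
  next
    show "((\<lambda>x. - 2 * K / sqrt x) \<longlongrightarrow> 0) at_top"
      by (intro tendsto_divide_0[OF tendsto_const] filterlim_at_top_imp_at_infinity sqrt_at_top)
  qed
  also have "\<dots> < \<infinity>" by simp
  finally show ?thesis unfolding nonquasianalytic_def .
qed

end

theorem theorem5p6:
  fixes \<omega> :: "real \<Rightarrow> real"
  assumes "weight_function \<omega>"
    and "\<omega> \<in> O[at_top](\<lambda>t. t)"
    and "(\<lambda>t. ln t) \<in> o[at_top](\<omega>)"
    and "convex_on UNIV (weight_phi \<omega>)"
    and "Liminf at_top (\<lambda>t. ereal (\<omega> t / t)) = 0"
  shows "(iota_star_condition \<omega> \<longleftrightarrow> hadamard_stable (F_roumieu \<omega>)) \<and>
         (iota_star_condition \<omega> \<longleftrightarrow> hadamard_stable (F_beurling \<omega>)) \<and>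
         (iota_star_condition \<omega> \<longrightarrow> nonquasianalytic \<omega>)"
proof -
  interpret log_small_weight \<omega> using assms by unfold_locales
  \<comment> \<open>The fixed ratio C is used in both directions: \<open>C * lam\<close> for given
    \<open>lam\<close> in the Roumieu case, \<open>lam' / C\<close> for given \<open>lam'\<close> in
    the Beurling case.\<close>
  have "hadamard_stable (F_roumieu \<omega>)" "hadamard_stable (F_beurling \<omega>)" if cond: "iota_star_condition \<omega>"
  proof -
    obtain C where C: "C > 0" "\<And>lam. lam > 0 \<Longrightarrow> square_dominated lam (C * lam)"
      using iota_star_condition_imp_square_dominated[OF cond] by blast
    show "hadamard_stable (F_roumieu \<omega>)"
      using C by (intro hadamard_stable_roumieu_if) (meson mult_pos_pos)
    have "\<exists>lam>0. square_dominated lam lam'" if "lam' > 0" for lam'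
      using C(2)[of "lam' / C"] C(1) that by (intro exI[of _ "lam' / C"]) simp
    then show "hadamard_stable (F_beurling \<omega>)" by (rule hadamard_stable_beurling_if)
  qed
  moreover have "iota_star_condition \<omega>" if "hadamard_stable (F_roumieu \<omega>)"
    using hadamard_stable_roumieu_imp[OF that] square_dominated_imp_iota_star_condition[OF assms(4)]
    by (meson zero_less_one)
  moreover have "iota_star_condition \<omega>" if "hadamard_stable (F_beurling \<omega>)"
    using hadamard_stable_beurling_imp[OF that] square_dominated_imp_iota_star_condition[OF assms(4)]
    by (meson zero_less_one)
  moreover have "nonquasianalytic \<omega>" if "iota_star_condition \<omega>"
    using iota_star_condition_sqrt_bound[OF that assms(5)] nonquasianalytic_if_sqrt_bound by metis
  ultimately show ?thesis by blast
qed

end
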